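(* For every integer $n \geq 1$, $$\int_0^1 \frac{\operatorname{Im}\bigl[\mathrm{Li}_{-2n}(i x)\bigr]}{x} \,\ln \ln \frac{1}{x} \,dx = (-1)^{n+1}\, \frac{2^{2n-1}(2n-1)!}{\pi^{2n-1}}\,\beta(2n).$$
   Context: For an integer $s$ and complex $z$ with $|z|<1$, the polylogarithm is $\mathrm{Li}_s(z) := \sum_{k=1}^{\infty} \frac{z^k}{k^s}$. Here $i$ is the imaginary unit, $\operatorname{Im}$ denotes the imaginary part, and $\ln\ln\frac1x = \ln(\ln(1/x))$ for $0<x<1$. Dirichlet's beta function is defined for $\Re(s)>0$ by $\beta(s) := \sum_{m=0}^\infty \frac{(-1)^m}{(2m+1)^s}$. *)

theory Defs
  imports "HOL-Analysis.Analysis"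
begin

text \<open>The polylogarithm series is re-indexed to start at 0, and is meaningful for \<open>norm z < 1\<close>.\<close>

definition polylog :: "int \<Rightarrow> complex \<Rightarrow> complex" where
  "polylog s z = (\<Sum>k. z ^ (k + 1) / of_nat (k + 1) powi s)"

text \<open>Meaningful for \<open>Re s > 0\<close>. For \<open>Re s \<le> 1\<close> the series converges only conditionally, so it is
  an ordered sum.\<close>

definition dirichlet_beta :: "complex \<Rightarrow> complex" where
  "dirichlet_beta s = (\<Sum>m. (-1) ^ m / of_nat (2 * m + 1) powr s)"

end

theory Submission
  imports Defs "HOL-Real_Asymp.Real_Asymp"
begin

text \<open>
  Substituting \<open>x = exp (- t)\<close> turns the integrand into \<open>f\<^sub>2\<^sub>n(t) ln t\<close> on \<open>t > 0\<close>, where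
  \<open>f\<^sub>j(t) = Im (Li\<^sub>-\<^sub>j (\<i> exp (- t)))\<close> is \<open>(-1)\<^sup>j\<close> times the \<open>j\<close>-th derivative of
  \<open>f\<^sub>0(t) = 1 / (2 cosh t)\<close>.
  The reflection formula of the digamma function gives
  \<open>pi / cosh t = Re (Digamma (3/4 + \<i> t / (2 pi)) - Digamma (1/4 + \<i> t / (2 pi)))\<close>,
  so after differentiating, \<open>f\<^sub>2\<^sub>n\<close> is an absolutely convergent combination of terms
  \<open>Re (1 / (a + \<i> t)\<^bsup>2n+1\<^esup>)\<close> with \<open>a\<close> an odd multiple of \<open>pi / 2\<close>. Against \<open>ln t\<close> each of these
  integrates to \<open>- pi / (4 n a\<^bsup>2n\<^esup>)\<close>, and the sum over \<open>a\<close> is the series of \<open>\<beta>(2n)\<close>.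
\<close>

subsection \<open>Logarithmic integrals of inverse powers\<close>

text \<open>The weight is a majorant free of \<open>a\<close>: near 0 only the logarithm is
  singular, and beyond 1 the factor t^(-3/2) beats it. Both branches are nonnegative, so explicit
  antiderivatives with finite limits at the ends suffice.\<close>

lemma set_integrable_log_weight:
  "set_integrable lborel {0<..} (\<lambda>t::real. if t < 1 then - ln t else ln t * t powr (-3/2))"
proof -
  have "set_integrable lborel (einterval 0 1) (\<lambda>t::real. - ln t)"
  proof (rule interval_integral_FTC_nonneg)
    show "DERIV (\<lambda>t. t - t * ln t) t :> - ln t" if "0 < ereal t" for t
      using that by (auto intro!: derivative_eq_intros)
    have "((\<lambda>t::real. t - t * ln t) \<longlongrightarrow> 0) (at_right 0)"
      by real_asymp
    then show "(((\<lambda>t. t - t * ln t) \<circ> real_of_ereal) \<longlongrightarrow> 0) (at_right 0)"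
      unfolding zero_ereal_def ereal_tendsto_simps .
    have "((\<lambda>t::real. t - t * ln t) \<longlongrightarrow> 1) (at_left 1)"
      by real_asymp
    then show "(((\<lambda>t. t - t * ln t) \<circ> real_of_ereal) \<longlongrightarrow> 1) (at_left 1)"
      unfolding one_ereal_def ereal_tendsto_simps .
  qed (auto simp: one_ereal_def intro!: AE_I2 continuous_intros)
  then have 1: "set_integrable lborel {0<..<1} (\<lambda>t::real. - ln t)"
    by (simp add: einterval_eq zero_ereal_def one_ereal_def del: ereal_eq_0 ereal_eq_1)
  have "set_integrable lborel (einterval 1 \<infinity>) (\<lambda>t::real. ln t * t powr (-3/2))"
  proof (rule interval_integral_FTC_nonneg)
    let ?F = "\<lambda>t::real. - 2 * t powr (-1/2) * ln t - 4 * t powr (-1/2)"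
    show "DERIV ?F t :> ln t * t powr (-3/2)" if "1 < ereal t" for t
    proof -
      \<comment> \<open>Writing t^(-1/2) as t^(-3/2) * t leaves a single power of t in the
        derivative of \<open>?F\<close>.\<close>
      have t: "t > 0" "t powr (-1/2) = t powr (-3/2) * t"
        using that powr_mult_base[of t "-3/2"] by (auto simp: one_ereal_def mult.commute)
      show ?thesis
        using t by (auto intro!: derivative_eq_intros simp: field_simps)
    qed
    have "(?F \<longlongrightarrow> 0) at_top"
      by real_asymp
    then show "((?F \<circ> real_of_ereal) \<longlongrightarrow> 0) (at_left \<infinity>)"
      unfolding ereal_tendsto_simps .
    have "(?F \<longlongrightarrow> -4) (at_right 1)"
      by real_asymp
    then show "((?F \<circ> real_of_ereal) \<longlongrightarrow> -4) (at_right 1)"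
      unfolding one_ereal_def ereal_tendsto_simps .
  qed (auto simp: one_ereal_def intro!: AE_I2 continuous_intros)
  then have 2: "set_integrable lborel {1<..} (\<lambda>t::real. ln t * t powr (-3/2))"
    by (simp add: einterval_eq one_ereal_def del: ereal_eq_1)
  let ?B = "\<lambda>t::real. if t < 1 then - ln t else ln t * t powr (-3/2)"
  have "set_integrable lborel ({0<..<1} \<union> {1} \<union> {1<..}) ?B"
  proof (intro set_integrable_Un)
    show "set_integrable lborel {0<..<1} ?B"
      using 1 by (rule set_integrable_cong[THEN iffD1, rotated 3]) auto
    show "set_integrable lborel {1<..} ?B"
      using 2 by (rule set_integrable_cong[THEN iffD1, rotated 3]) auto
  qed auto
  moreover have "{0<..<1} \<union> {1} \<union> {1<..} = {0::real<..}"
    by auto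
  ultimately show ?thesis
    by simp
qed

lemma continuous_on_Re_inverse_power:
  assumes "a > 0"
  shows "continuous_on UNIV (\<lambda>t. Re (inverse (Complex a t ^ m)))"
proof -
  have "Complex a t \<noteq> 0" for t
    using assms by (simp add: complex_eq_iff)
  moreover have "(\<lambda>t. Complex a t) = (\<lambda>t. of_real a + \<i> * of_real t)"
    by (simp add: fun_eq_iff complex_eq_iff)
  then have "continuous_on UNIV (\<lambda>t. Complex a t)"
    by (simp only:) (intro continuous_intros)
  ultimately show ?thesis
    by (intro continuous_intros) auto
qed

text \<open>With r = |a + \<i>t|, the bound r^(-3) splits into two factors r^(-3/2). One yields
  a^(-3/2), which is summable when \<open>a\<close> runs through an arithmetic progression; the
  other controls \<open>t\<close>, being at most 1 and at most t^(-3/2).\<close>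

lemma norm_log_term_le:
  fixes a t :: real
  assumes a: "a \<ge> 1" and t: "t > 0" and m: "m \<ge> 3"
  shows "norm (Re (inverse (Complex a t ^ m)) * ln t)
           \<le> a powr (-3/2) * (if t < 1 then - ln t else ln t * t powr (-3/2))"
proof -
  define r where "r = cmod (Complex a t)"
  have r: "r \<ge> a" "r \<ge> t"
    using abs_Re_le_cmod[of "Complex a t"] abs_Im_le_cmod[of "Complex a t"] a t by (auto simp: r_def)
  have "norm (Re (inverse (Complex a t ^ m))) \<le> norm (inverse (Complex a t ^ m))"
    unfolding real_norm_def by (rule abs_Re_le_cmod)
  also have "\<dots> = inverse (r ^ m)"
    by (simp add: norm_inverse norm_power r_def)
  also have "\<dots> \<le> inverse (r ^ 3)"
    using r a m by (intro le_imp_inverse_le power_increasing) auto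
  also have "\<dots> = r powr (-3/2) * r powr (-3/2)"
    using r a powr_minus[of r 3] by (simp add: powr_add[symmetric] powr_numeral)
  finally have 1: "norm (Re (inverse (Complex a t ^ m))) \<le> r powr (-3/2) * r powr (-3/2)" .
  have ra: "r powr (-3/2) \<le> a powr (-3/2)" and rt: "r powr (-3/2) \<le> t powr (-3/2)"
    using r a t by (auto intro!: powr_mono2')
  have r1: "r powr (-3/2) \<le> 1"
    using r a powr_mono2'[of "-3/2" 1 r] by simp
  define x where "x = Re (inverse (Complex a t ^ m))"
  note 1 = 1[folded x_def]
  show ?thesis
  proof (cases "t < 1")
    case True
    have "norm (x) \<le> a powr (-3/2) * 1"
      using 1 by (rule order_trans) (intro mult_mono ra r1, auto)
    then have "norm x * - ln t \<le> a powr (-3/2) * - ln t"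
      using True t by (intro mult_right_mono) auto
    then show ?thesis
      unfolding x_def[symmetric] using True t by (simp add: abs_mult)
  next
    case False
    have "norm (x) \<le> a powr (-3/2) * t powr (-3/2)"
      using 1 by (rule order_trans) (intro mult_mono ra rt, auto)
    then have "norm (x) * ln t \<le> a powr (-3/2) * t powr (-3/2) * ln t"
      using False by (intro mult_right_mono) auto
    then show ?thesis
      unfolding x_def[symmetric] using False by (simp add: abs_mult mult_ac)
  qed
qed

lemma set_integrable_log_term:
  assumes "a \<ge> 1" "m \<ge> 3"
  shows "set_integrable lborel {0<..} (\<lambda>t. Re (inverse (Complex a t ^ m)) * ln t)"
proof (rule set_integrable_bound)
  show "set_integrable lborel {0<..}
      (\<lambda>t::real. a powr (-3/2) * (if t < 1 then - ln t else ln t * t powr (-3/2)))"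
    using set_integrable_log_weight by (rule set_integrable_mult_right)
  have "(\<lambda>t. indicator {0<..} t *\<^sub>R (Re (inverse (Complex a t ^ m)) * ln t)) \<in> borel_measurable borel"
    using assms
    by (intro borel_measurable_continuous_on_indicator continuous_on_mult continuous_on_ln
        continuous_on_subset[OF continuous_on_Re_inverse_power] continuous_on_id) auto
  then show "set_borel_measurable lborel {0<..} (\<lambda>t. Re (inverse (Complex a t ^ m)) * ln t)"
    by (simp only: set_borel_measurable_def measurable_lborel2)
  show "AE t in lborel. t \<in> {0<..} \<longrightarrow> norm (Re (inverse (Complex a t ^ m)) * ln t)
      \<le> norm (a powr (-3/2) * (if t < 1 then - ln t else ln t * t powr (-3/2)))"
  proof (intro AE_I2 impI)
    fix t :: real assume "t \<in> {0<..}"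
    with norm_log_term_le[OF assms(1) _ assms(2), of t]
    show "norm (Re (inverse (Complex a t ^ m)) * ln t)
      \<le> norm (a powr (-3/2) * (if t < 1 then - ln t else ln t * t powr (-3/2)))"
      by (auto split: if_splits)
  qed
qed

section \<open>Derivatives and boundary behaviour of (a + \<i>t)^(-m), and the exact logarithmic
  integral\<close>

lemma has_vector_derivative_inverse_Complex_power:
  assumes "a > 0"
  shows "((\<lambda>t. inverse (Complex a t ^ m)) has_vector_derivative
           - of_nat m * \<i> * inverse (Complex a t ^ Suc m)) (at t)"
proof -
  have nz: "Complex a t \<noteq> 0"
    using assms by (simp add: complex_eq_iff)
  have "((\<lambda>w. inverse (w ^ m)) has_field_derivative - of_nat m * inverse (w ^ Suc m)) (at w)"
    if "w \<noteq> 0" for w :: complex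
    using DERIV_power[OF DERIV_inverse[OF that], of m]
    by (cases m) (simp_all add: power_inverse algebra_simps)
  note deriv = this
  have "((\<lambda>z. inverse ((of_real a + \<i> * z) ^ m)) has_field_derivative
           - of_nat m * \<i> * inverse (Complex a t ^ Suc m)) (at (of_real t))"
    by (rule DERIV_chain2[OF deriv, where Db = \<i> and g = "\<lambda>z. of_real a + \<i> * z", THEN DERIV_cong])
       (use nz in \<open>auto intro!: derivative_eq_intros simp: Complex_eq\<close>)
  from has_vector_derivative_real_field[OF this] show ?thesis
    by (simp add: o_def Complex_eq)
qed

lemma DERIV_Im_inverse_power:
  assumes "a > 0"
  shows "DERIV (\<lambda>t. Im (inverse (Complex a t ^ m))) t :> - real m * Re (inverse (Complex a t ^ Suc m))"
  using bounded_linear.has_vector_derivative[OF bounded_linear_Im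
      has_vector_derivative_inverse_Complex_power[OF assms]]
  by (simp add: has_real_derivative_iff_has_vector_derivative mult.assoc del: power_Suc)

text \<open>Imaginary parts of (a + \<i>t)^(-m) = (a + \<i>t) (a + \<i>t)^(-m-1). This drives the
  recursion for the antiderivative.\<close>

lemma Im_inverse_power_Suc:
  assumes "a > 0"
  shows "a * Im (inverse (Complex a t ^ Suc m)) =
    Im (inverse (Complex a t ^ m)) - t * Re (inverse (Complex a t ^ Suc m))"
proof -
  have "Complex a t \<noteq> 0"
    using assms by (simp add: complex_eq_iff)
  then have "inverse (Complex a t ^ m) = Complex a t * inverse (Complex a t ^ Suc m)"
    by (simp add: field_simps)
  then have "Im (inverse (Complex a t ^ m)) = Im (Complex a t * inverse (Complex a t ^ Suc m))"
    by (simp only:)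
  then show ?thesis
    by (simp del: power_Suc)
qed

lemma Im_inverse_Complex_0_power: "Im (inverse (Complex a 0 ^ m)) = 0"
  by (simp flip: complex_of_real_def of_real_power of_real_inverse)

lemma tendsto_Im_inverse_power_at_top:
  assumes "a > 0" "m > 0"
  shows "((\<lambda>t. Im (inverse (Complex a t ^ m)) * ln t) \<longlongrightarrow> 0) at_top"
proof (rule Lim_null_comparison)
  show "((\<lambda>t::real. ln t / t) \<longlongrightarrow> 0) at_top"
    by real_asymp
  show "\<forall>\<^sub>F t in at_top. norm (Im (inverse (Complex a t ^ m)) * ln t) \<le> ln t / t"
    using eventually_ge_at_top[of 1]
  proof eventually_elim
    case (elim t)
    have r: "cmod (Complex a t) \<ge> t"
      using abs_Im_le_cmod[of "Complex a t"] elim by simp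
    have "\<bar>Im (inverse (Complex a t ^ m))\<bar> \<le> cmod (inverse (Complex a t ^ m))"
      by (rule abs_Im_le_cmod)
    also have "\<dots> = inverse (cmod (Complex a t) ^ m)"
      by (simp add: norm_inverse norm_power)
    also have "\<dots> \<le> inverse (t ^ 1)"
      using r elim assms(2)
      by (intro le_imp_inverse_le order_trans[OF power_increasing power_mono]) auto
    finally show ?case
      using elim mult_right_mono[of _ "inverse (t ^ 1)" "ln t"] by (simp add: abs_mult divide_simps)
  qed
qed

text \<open>The imaginary part vanishes at t = 0, so its quotient by \<open>t\<close> tends to the
  derivative there, while t ln t tends to 0.\<close>

lemma tendsto_Im_inverse_power_at_right_0:
  assumes "a > 0"
  shows "((\<lambda>t. Im (inverse (Complex a t ^ m)) * ln t) \<longlongrightarrow> 0) (at_right 0)"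
proof -
  let ?P = "\<lambda>t. Im (inverse (Complex a t ^ m))"
  have "((\<lambda>t. ?P t / t) \<longlongrightarrow> - real m * Re (inverse (Complex a 0 ^ Suc m))) (at 0)"
    using DERIV_Im_inverse_power[OF assms, of m 0] Im_inverse_Complex_0_power[of a m]
    by (simp add: has_field_derivative_iff del: power_Suc)
  then have "((\<lambda>t. ?P t / t) \<longlongrightarrow> - real m * Re (inverse (Complex a 0 ^ Suc m))) (at_right 0)"
    by (rule tendsto_mono[OF at_le, rotated]) simp
  moreover have "((\<lambda>t::real. t * ln t) \<longlongrightarrow> 0) (at_right 0)"
    by real_asymp
  ultimately have "((\<lambda>t. ?P t / t * (t * ln t)) \<longlongrightarrow> 0) (at_right 0)"
    using tendsto_mult by fastforce
  then show ?thesis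
    by (rule Lim_transform_eventually) (auto simp: eventually_at_right_less eventually_at_filter)
qed

text \<open>The antiderivative is built by recursion on \<open>m\<close>: dividing by \<open>t\<close> in
  \<open>Im_inverse_power_Suc\<close> expresses the integrand for \<open>Suc m\<close> by that for \<open>m\<close> and an exact
  derivative, down to \<open>arctan\<close> at \<open>m = 1\<close>.\<close>

lemma antiderivative_Im_inverse_power_over:
  assumes a: "a > 0" and m: "m > 0"
  obtains A where
    "\<And>t. t > 0 \<Longrightarrow> DERIV A t :> Im (inverse (Complex a t ^ m)) / t"
    "(A \<longlongrightarrow> 0) (at_right 0)"
    "(A \<longlongrightarrow> - (pi / 2) * inverse (a ^ m)) at_top"
proof -
  have "\<exists>A. (\<forall>t>0. DERIV A t :> Im (inverse (Complex a t ^ m)) / t) \<and>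
    (A \<longlongrightarrow> 0) (at_right 0) \<and> (A \<longlongrightarrow> - (pi / 2) * inverse (a ^ m)) at_top"
    using m
  proof (induction m rule: nat_induct_non_zero)
    case 1
    have "DERIV (\<lambda>t. - arctan (t / a) / a) t :> Im (inverse (Complex a t ^ 1)) / t" if "t > 0" for t
    proof -
      obtain q where q: "q = a\<^sup>2 + t\<^sup>2" "q \<noteq> 0"
        using a by (simp add: add_pos_nonneg)
      have "1 + (t / a)\<^sup>2 = q / a\<^sup>2"
        using a by (simp add: q field_simps)
      then have "- (inverse (1 + (t / a)\<^sup>2) * (1 / a)) / a = - 1 / q"
        using a by (simp add: power2_eq_square)
      moreover have "Im (inverse (Complex a t ^ 1)) / t = - 1 / q"
        using that by (simp add: q)
      moreover have "DERIV (\<lambda>t. - arctan (t / a) / a) t :> - (inverse (1 + (t / a)\<^sup>2) * (1 / a)) / a"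
        using a by (auto intro!: derivative_eq_intros)
      ultimately show ?thesis
        by (simp only:)
    qed
    moreover have "((\<lambda>t. - arctan (t / a) / a) \<longlongrightarrow> 0) (at_right 0)"
      using a by (auto intro!: tendsto_eq_intros)
    moreover have "((\<lambda>t. arctan (t / a)) \<longlongrightarrow> pi / 2) at_top"
      using a by (intro filterlim_compose[OF tendsto_arctan_at_top]) real_asymp
    then have "((\<lambda>t. - arctan (t / a) / a) \<longlongrightarrow> - (pi / 2) / a) at_top"
      using a by (intro tendsto_intros) auto
    then have "((\<lambda>t. - arctan (t / a) / a) \<longlongrightarrow> - (pi / 2) * inverse (a ^ 1)) at_top"
      by (simp only: divide_inverse power_one_right)
    ultimately show ?case
      by blast
  next
    case (Suc m)
    then obtain A where A: "\<And>t. t > 0 \<Longrightarrow> DERIV A t :> Im (inverse (Complex a t ^ m)) / t"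
      "(A \<longlongrightarrow> 0) (at_right 0)" "(A \<longlongrightarrow> - (pi / 2) * inverse (a ^ m)) at_top"
      by blast
    let ?P = "\<lambda>t. Im (inverse (Complex a t ^ m))"
    \<comment> \<open>By \<open>Im_inverse_power_Suc\<close> the new integrand is
      (\<open>?P t\<close> / t - Re (a + \<i>t)^(-m-1)) / a, and the subtracted real part is -1/m
      times the derivative of \<open>?P\<close>.\<close>
    let ?A = "\<lambda>t. (A t + ?P t / m) / a"
    have "DERIV ?A t :> Im (inverse (Complex a t ^ Suc m)) / t" if "t > 0" for t
    proof -
      have "DERIV ?A t :> (?P t / t + (- real m * Re (inverse (Complex a t ^ Suc m))) / m) / a"
        using that by (intro DERIV_cdivide DERIV_add A DERIV_Im_inverse_power a)
      moreover have "(p / t + (- real m * r) / m) / a = q / t" if "a * q = p - t * r" for p q r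
      proof -
        have p: "p = a * q + t * r"
          using that by simp
        show ?thesis
          unfolding p using \<open>t > 0\<close> a Suc.hyps by (simp add: field_simps)
      qed
      note this[OF Im_inverse_power_Suc[OF a]]
      ultimately show ?thesis
        by (simp only:)
    qed
    moreover have "(?A \<longlongrightarrow> 0) (at_right 0)"
    proof -
      have "(?P \<longlongrightarrow> 0) (at_right 0)"
        using DERIV_isCont[OF DERIV_Im_inverse_power[OF a, of m 0]] Im_inverse_Complex_0_power[of a m]
        by (auto simp: isCont_def intro: tendsto_mono[OF at_le])
      from tendsto_divide[OF tendsto_add[OF A(2) tendsto_divide[OF this tendsto_const]] tendsto_const]
      show ?thesis
        using a Suc.hyps by fastforce
    qed
    moreover have "(?A \<longlongrightarrow> - (pi / 2) * inverse (a ^ Suc m)) at_top"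
    proof -
      \<comment> \<open>The decay of \<open>?P\<close> is read off from that of
        \<open>?P t * ln t\<close> by dividing the logarithm out again.\<close>
      have "((\<lambda>t. ?P t * ln t * (1 / ln t)) \<longlongrightarrow> 0 * 0) at_top"
        using a Suc.hyps
        by (intro tendsto_mult tendsto_Im_inverse_power_at_top) (simp_all, real_asymp)
      moreover have "\<forall>\<^sub>F t in at_top. ?P t * ln t * (1 / ln t) = ?P t"
        using eventually_gt_at_top[of 1] by eventually_elim simp
      ultimately have "(?P \<longlongrightarrow> 0) at_top"
        using Lim_transform_eventually by fastforce
      from tendsto_divide[OF tendsto_add[OF A(3) tendsto_divide[OF this tendsto_const]] tendsto_const]
      have "(?A \<longlongrightarrow> (- (pi / 2) * inverse (a ^ m) + 0 / m) / a) at_top"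
        using a Suc.hyps by fastforce
      then show ?thesis
        by (simp add: field_simps)
    qed
    ultimately show ?case
      by blast
  qed
  with that show ?thesis
    by blast
qed

text \<open>Since Re (a + \<i>t)^(-m-1) is -1/m times the derivative of Im (a + \<i>t)^(-m), the
  logarithm can be traded for 1/t. The boundary terms vanish, and the limit of the antiderivative at
  infinity, divided by \<open>m\<close>, is the value.\<close>

lemma integral_log_term:
  assumes a: "a \<ge> 1" and m: "m \<ge> 2"
  shows "(LBINT t:{0<..}. Re (inverse (Complex a t ^ Suc m)) * ln t) =
    - (pi / (2 * m)) * inverse (a ^ m)"
proof -
  have a0: "a > 0" and m0: "m > 0"
    using a m by auto
  obtain A where A: "\<And>t. t > 0 \<Longrightarrow> DERIV A t :> Im (inverse (Complex a t ^ m)) / t"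
    "(A \<longlongrightarrow> 0) (at_right 0)" "(A \<longlongrightarrow> - (pi / 2) * inverse (a ^ m)) at_top"
    using antiderivative_Im_inverse_power_over[OF a0 m0] by blast
  let ?R = "\<lambda>t. Re (inverse (Complex a t ^ Suc m)) * ln t"
  let ?P = "\<lambda>t. Im (inverse (Complex a t ^ m))"
  \<comment> \<open>integration by parts against \<open>ln t\<close>\<close>
  let ?H = "\<lambda>t. (A t - ?P t * ln t) / m"
  have "(LBINT t=0..\<infinity>. ?R t) = - (pi / 2) * inverse (a ^ m) / m - 0"
  proof (rule interval_integral_FTC_integrable)
    show "(?H has_vector_derivative ?R t) (at t)" if "0 < ereal t" for t
    proof -
      have t: "t > 0"
        using that by simp
      have "DERIV ?H t :> (?P t / t - (- real m * Re (inverse (Complex a t ^ Suc m)) * ln t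
              + inverse t * ?P t)) / m"
        using t by (intro DERIV_cdivide DERIV_diff DERIV_mult A DERIV_Im_inverse_power a0 DERIV_ln)
      moreover have "(p / t - (- real m * r * l + inverse t * p)) / m = r * l" for p r l
        using m0 t by (simp add: field_simps)
      ultimately show ?thesis
        by (simp only: has_real_derivative_iff_has_vector_derivative)
    qed
    show "isCont ?R t" if "0 < ereal t" for t
      using that continuous_on_Re_inverse_power[OF a0, of "Suc m"]
      by (intro continuous_intros) (auto simp: continuous_on_eq_continuous_at)
    show "set_integrable lborel (einterval 0 \<infinity>) ?R"
      using set_integrable_log_term[OF a, of "Suc m"] m
      by (simp add: einterval_eq zero_ereal_def del: ereal_eq_0 power_Suc)
    have "(?H \<longlongrightarrow> (0 - 0) / m) (at_right 0)"
      using m0 by (intro tendsto_intros A tendsto_Im_inverse_power_at_right_0 a0) auto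
    then show "((?H \<circ> real_of_ereal) \<longlongrightarrow> 0) (at_right 0)"
      unfolding zero_ereal_def ereal_tendsto_simps by simp
    have "(?H \<longlongrightarrow> (- (pi / 2) * inverse (a ^ m) - 0) / m) at_top"
      using m0 by (intro tendsto_intros A tendsto_Im_inverse_power_at_top a0) auto
    then show "((?H \<circ> real_of_ereal) \<longlongrightarrow> - (pi / 2) * inverse (a ^ m) / m) (at_left \<infinity>)"
      unfolding ereal_tendsto_simps by simp
  qed simp
  then show ?thesis
    by (simp add: interval_lebesgue_integral_def einterval_eq zero_ereal_def
        del: ereal_eq_0 power_Suc)
qed

section \<open>Termwise integration of the series, applied to polygamma functions\<close>

text \<open>The bound \<open>norm_log_term_le\<close> separates \<open>k\<close> from
  \<open>t\<close>, so the integrals of the absolute values are dominated by a constant times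
  a_k^(-3/2). This justifies exchanging sum and integral.\<close>

lemma
  fixes a :: "nat \<Rightarrow> real"
  assumes a: "\<And>k. a k \<ge> 1" and sum: "summable (\<lambda>k. a k powr (-3/2))" and m: "m \<ge> 2"
  shows set_integrable_log_series:
      "set_integrable lborel {0<..} (\<lambda>t. (\<Sum>k. Re (inverse (Complex (a k) t ^ Suc m))) * ln t)"
    and sums_integral_log_series:
      "(\<lambda>k. - (pi / (2 * m)) * inverse (a k ^ m)) sums
         (LBINT t:{0<..}. (\<Sum>k. Re (inverse (Complex (a k) t ^ Suc m))) * ln t)"
proof -
  let ?B = "\<lambda>t::real. if t < 1 then - ln t else ln t * t powr (-3/2)"
  let ?R = "\<lambda>k t. Re (inverse (Complex (a k) t ^ Suc m))"
  let ?f = "\<lambda>k t. indicator {0<..} t *\<^sub>R (?R k t * ln t)"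
  have m3: "Suc m \<ge> 3"
    using m by simp
  have int: "integrable lborel (?f k)" for k
    using set_integrable_log_term[OF a m3, of k] by (simp only: set_integrable_def)
  have bound: "norm (?f k t) \<le> a k powr (-3/2) * (indicator {0<..} t *\<^sub>R ?B t)" for k t
    using norm_log_term_le[OF a _ m3, of t k] by (auto simp: indicator_def simp del: power_Suc)
  have summable: "summable (\<lambda>k. norm (?f k t))" for t
    using summable_mult2[OF sum, of "indicator {0<..} t *\<^sub>R ?B t"]
    by (rule summable_comparison_test', use bound in simp)
  have summable_int: "summable (\<lambda>k. LINT t|lborel. norm (?f k t))"
  proof (rule summable_comparison_test')
    show "summable (\<lambda>k. a k powr (-3/2) * (LBINT t:{0<..}. ?B t))"
      using sum by (rule summable_mult2)
    show "norm (LINT t|lborel. norm (?f k t)) \<le> a k powr (-3/2) * (LBINT t:{0<..}. ?B t)" for k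
    proof -
      have "(LINT t|lborel. norm (?f k t)) \<le>
          (LINT t|lborel. a k powr (-3/2) * (indicator {0<..} t *\<^sub>R ?B t))"
        using set_integrable_log_weight
        by (intro integral_mono integrable_norm int integrable_mult_right bound)
           (simp only: set_integrable_def)
      also have "\<dots> = a k powr (-3/2) * (LBINT t:{0<..}. ?B t)"
        by (simp only: integral_mult_right_zero set_lebesgue_integral_def)
      finally show ?thesis
        by (simp only: real_norm_def abs_of_nonneg Bochner_Integration.integral_nonneg norm_ge_zero)
    qed
  qed
  have eq: "(\<Sum>k. ?f k t) = indicator {0<..} t *\<^sub>R ((\<Sum>k. ?R k t) * ln t)" for t
  \<comment> \<open>Summability of \<open>?R k t\<close> is recovered by cancelling
    \<open>ln t\<close>. Where that fails, at t = 1, both sides are 0.\<close>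
  proof (cases "t > 0 \<and> ln t \<noteq> 0")
    case True
    then have "summable (\<lambda>k. ?R k t * ln t)"
      using summable_norm_cancel[OF summable[of t]] by simp
    then have "summable (\<lambda>k. ?R k t)"
      using True by (subst (asm) mult.commute) (simp only: summable_cmult_iff, simp)
    then show ?thesis
      using True suminf_mult2[of "\<lambda>k. ?R k t" "ln t"] by simp
  qed auto
  show "set_integrable lborel {0<..} (\<lambda>t. (\<Sum>k. ?R k t) * ln t)"
    using integrable_suminf[OF int AE_I2[OF summable] summable_int]
    by (simp only: eq set_integrable_def)
  have "(\<lambda>k. LINT t|lborel. ?f k t) sums (LINT t|lborel. (\<Sum>k. ?f k t))"
    using sums_integral[OF int AE_I2[OF summable] summable_int] .
  moreover have "(LINT t|lborel. ?f k t) = - (pi / (2 * m)) * inverse (a k ^ m)" for k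
    using integral_log_term[OF a m] by (simp only: set_lebesgue_integral_def)
  ultimately show "(\<lambda>k. - (pi / (2 * m)) * inverse (a k ^ m)) sums
         (LBINT t:{0<..}. (\<Sum>k. ?R k t) * ln t)"
    by (simp only: eq set_lebesgue_integral_def)
qed

text \<open>Scaling by 2 pi turns the polygamma series at c + \<i>t/(2 pi) into the series of the
  previous lemma, with a_k = 2 pi (c + k). The hypothesis on \<open>c\<close> makes every a_k at
  least 1.\<close>

lemma
  fixes c :: real
  assumes c: "2 * pi * c \<ge> 1" and m: "m \<ge> 2"
  shows set_integrable_Polygamma_log:
      "set_integrable lborel {0<..} (\<lambda>t. Re (Polygamma m (Complex c (t / (2 * pi)))) * ln t)"
    and sums_integral_Polygamma_log:
      "(\<lambda>k. (-1) ^ m * fact (m - 1) * pi\<^sup>2 * inverse ((c + real k) ^ m)) sums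
         (LBINT t:{0<..}. Re (Polygamma m (Complex c (t / (2 * pi)))) * ln t)"
proof -
  define a where "a = (\<lambda>k::nat. 2 * pi * (c + real k))"
  define C where "C = (-1) ^ Suc m * fact m * (2 * pi) ^ Suc m"
  have c0: "c > 0"
  proof -
    have "0 < 2 * pi * c"
      using c by linarith
    then show ?thesis
      by (simp add: zero_less_mult_iff)
  qed
  have a: "a k \<ge> 1" for k
    using c by (simp add: a_def ring_distribs add_increasing2)
  have ak: "a k \<ge> k" for k
    using c0 pi_ge_two mult_mono[of 1 "2 * pi" k "c + real k"] by (simp add: a_def)
  have sum: "summable (\<lambda>k. a k powr (-3/2))"
  proof (rule summable_comparison_test)
    show "summable (\<lambda>k. real k powr (-3/2))"
      by (simp add: summable_real_powr_iff)
    \<comment> \<open>The comparison starts at 1 because \<open>0 powr (-3/2)\<close> is 0.\<close>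
    show "\<exists>N. \<forall>k\<ge>N. norm (a k powr (-3/2)) \<le> real k powr (-3/2)"
      using ak by (intro exI[of _ 1]) (auto intro!: powr_mono2')
  qed
  have shift: "inverse ((Complex c (t / (2 * pi)) + of_nat k) ^ Suc m) =
      of_real ((2 * pi) ^ Suc m) * inverse (Complex (a k) t ^ Suc m)" for t k
  proof -
    have "Complex c (t / (2 * pi)) + of_nat k = Complex (a k) t / of_real (2 * pi)"
      by (simp add: complex_eq_iff a_def)
    then show ?thesis
      by (simp only: power_divide inverse_divide of_real_power) (simp add: field_simps)
  qed
  have eq: "Re (Polygamma m (Complex c (t / (2 * pi)))) =
      C * (\<Sum>k. Re (inverse (Complex (a k) t ^ Suc m)))" for t
  proof -
    have nz: "Complex c (t / (2 * pi)) \<noteq> 0"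
      using c0 by (simp add: complex_eq_iff)
    have "summable (\<lambda>k. inverse ((Complex c (t / (2 * pi)) + of_nat k) ^ Suc m))"
      using Polygamma_converges'[OF nz, of "Suc m"] m by simp
    then have s: "summable (\<lambda>k. inverse (Complex (a k) t ^ Suc m))"
      unfolding shift by (subst (asm) summable_cmult_iff) auto
    have "Polygamma m (Complex c (t / (2 * pi))) = of_real C * (\<Sum>k. inverse (Complex (a k) t ^ Suc m))"
      using m by (simp only: Polygamma_def shift suminf_mult[OF s]) (simp add: C_def)
    then show ?thesis
      by (simp only: bounded_linear.suminf[OF bounded_linear_Re s, symmetric] times_complex.sel Re_complex_of_real Im_complex_of_real mult_zero_left diff_zero)
  qed
  show "set_integrable lborel {0<..} (\<lambda>t. Re (Polygamma m (Complex c (t / (2 * pi)))) * ln t)"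
    unfolding eq mult.assoc using set_integrable_log_series[OF a sum m]
    by (intro set_integrable_mult_right)
  \<comment> \<open>One factor 2 pi of \<open>C\<close> survives the division by a_k^m. With pi /
    (2m) it makes pi^2 / m, and the \<open>m\<close> turns m! into (m-1)!.\<close>
  have const: "C * (- (pi / (2 * m)) * inverse (a k ^ m)) =
      (-1) ^ m * fact (m - 1) * pi\<^sup>2 * inverse ((c + real k) ^ m)" for k
  proof -
    have f: "fact m = real m * fact (m - 1)"
      using m by (simp add: fact_reduce)
    obtain q where q: "c + real k = q" "q > 0"
      using c0 by simp
    show ?thesis
      unfolding C_def a_def q f using m q(2)
      by (simp add: power_mult_distrib field_simps power2_eq_square)
  qed
  show "(\<lambda>k. (-1) ^ m * fact (m - 1) * pi\<^sup>2 * inverse ((c + real k) ^ m)) sums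
         (LBINT t:{0<..}. Re (Polygamma m (Complex c (t / (2 * pi)))) * ln t)"
    using sums_mult[OF sums_integral_log_series[OF a sum m], of C]
    unfolding const eq mult.assoc set_integral_mult_right .
qed

subsection \<open>The hyperbolic secant as a digamma difference\<close>

lemma Digamma_reflection_complex:
  fixes z :: complex
  assumes "z \<notin> \<int>"
  shows "Digamma (1 - z) - Digamma z = of_real pi * cot (of_real pi * z)"
proof -
  let ?p = "complex_of_real pi"
  have z: "z \<notin> \<int>\<^sub>\<le>\<^sub>0" "1 - z \<notin> \<int>\<^sub>\<le>\<^sub>0"
    using assms nonpos_Ints_Int[of "1 - z"] Ints_diff[of 1 "1 - z"] by (auto dest: nonpos_Ints_Int)
  have sin: "sin (?p * w) \<noteq> 0" if "w \<notin> \<int>" for w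
    using that sin_eq_0[of "?p * w"] by (auto simp: Ints_def mult.commute)
  \<comment> \<open>logarithmic derivative of the reflection formula for \<open>Gamma\<close>\<close>
  let ?g = "\<lambda>z. Gamma z * Gamma (1 - z) * sin (?p * z)"
  have "(?g has_field_derivative
      Gamma z * Gamma (1 - z) * ((Digamma z - Digamma (1 - z)) * sin (?p * z) + ?p * cos (?p * z))) (at z)"
    using z by (auto intro!: derivative_eq_intros simp: algebra_simps)
  \<comment> \<open>The reflection formula makes \<open>?g\<close> equal to pi on the complement of
    the integers, which is an open neighbourhood of \<open>z\<close>.\<close>
  moreover have "(?g has_field_derivative 0) (at z)"
  proof (rule DERIV_cong_ev[THEN iffD1])
    show "((\<lambda>_. ?p) has_field_derivative 0) (at z)"
      by simp
    have "eventually (\<lambda>w. w \<in> - \<int>) (nhds z)"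
      using assms closed_Ints by (intro eventually_nhds_in_open) (auto simp: closed_def)
    then show "eventually (\<lambda>w. ?p = ?g w) (nhds z)"
      by eventually_elim (use sin in \<open>auto simp: Gamma_reflection_complex\<close>)
  qed auto
  ultimately have "Gamma z * Gamma (1 - z) *
      ((Digamma z - Digamma (1 - z)) * sin (?p * z) + ?p * cos (?p * z)) = 0"
    by (rule DERIV_unique)
  then have "(Digamma z - Digamma (1 - z)) * sin (?p * z) + ?p * cos (?p * z) = 0"
    using z by (auto simp: Gamma_eq_zero_iff)
  then show ?thesis
    using sin[OF assms] by (auto simp: cot_def field_simps add_eq_0_iff)
qed

lemma cnj_Digamma: "Digamma (cnj z) = cnj (Digamma z)" if "z \<noteq> 0"
proof -
  have "(\<lambda>k. cnj (inverse (of_nat (Suc k)) - inverse (z + of_nat k))) sums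
      cnj (\<Sum>k. inverse (of_nat (Suc k)) - inverse (z + of_nat k))"
    unfolding sums_cnj using summable_Digamma[OF that] by (rule summable_sums)
  then have "(\<Sum>k. inverse (of_nat (Suc k)) - inverse (cnj z + of_nat k)) =
      cnj (\<Sum>k. inverse (of_nat (Suc k)) - inverse (z + of_nat k))"
    by (simp add: sums_iff del: of_nat_Suc)
  then show ?thesis
    by (simp add: Digamma_def euler_mascheroni_def del: of_nat_Suc)
qed

text \<open>Since 1/4 + 3/4 = 1, the reflections of \<open>z\<close> and \<open>w\<close> are each
  other's conjugates. Subtracting the two reflection formulas gives twice the real part as pi (cot
  (pi z) - cot (pi w)), and w = z + 1/2 turns this into 2 pi / sin (2 pi z).\<close>

lemma Re_Digamma_quarters:
  fixes t :: real
  shows "Re (Digamma (Complex (3/4) (t / (2 * pi))) - Digamma (Complex (1/4) (t / (2 * pi)))) =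
    pi / cosh t"
proof -
  define z where "z = Complex (1/4) (t / (2 * pi))"
  define w where "w = Complex (3/4) (t / (2 * pi))"
  let ?p = "complex_of_real pi"
  have nz: "z \<noteq> 0" "w \<noteq> 0"
    by (auto simp: z_def w_def complex_eq_iff)
  have zw: "1 - z = cnj w" "1 - w = cnj z" "w = z + 1 / 2"
    by (auto simp: z_def w_def complex_eq_iff)
  have int: "real_of_int (i * 4) \<noteq> real_of_int 1" "real_of_int (i * 4) \<noteq> real_of_int 3" for i
    by (simp_all only: of_int_eq_iff) presburger+
  have "z \<notin> \<int>" "w \<notin> \<int>"
    using int by (auto simp: z_def w_def complex_is_Int_iff field_simps)
  then have *: "cnj (Digamma w) - Digamma z = ?p * cot (?p * z)"
    "cnj (Digamma z) - Digamma w = ?p * cot (?p * w)"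
    using Digamma_reflection_complex[of z] Digamma_reflection_complex[of w] nz
    by (simp_all add: zw(1,2) cnj_Digamma)
  have "?p * w = ?p * z + of_real pi / 2"
    by (simp add: zw field_simps)
  then have cw: "cot (?p * w) = - sin (?p * z) / cos (?p * z)"
    using sin_cos_eq[of "- (?p * z)"] cos_sin_eq[of "- (?p * z)"]
    by (simp add: cot_def sin_add cos_add)
  have c: "2 * (sin (?p * z) * cos (?p * z)) = of_real (cosh t)"
  proof -
    \<comment> \<open>The real part 1/4 becomes a quarter turn, so the sine is a cosine of an
      imaginary argument, which is cosh t.\<close>
    have "2 * (?p * z) = of_real pi / 2 + \<i> * of_real t"
      by (simp add: z_def complex_eq_iff)
    then have "sin (2 * (?p * z)) = cos (\<i> * of_real t)"
      by (simp add: sin_add)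
    also have "\<dots> = of_real (cosh t)"
      by (simp add: cos_i_times cosh_field_def exp_of_real exp_minus)
    finally show ?thesis
      by (simp only: sin_double mult.assoc)
  qed
  have nz: "sin (?p * z) \<noteq> 0" "cos (?p * z) \<noteq> 0"
    using c by auto
  have "cot (?p * z) - cot (?p * w) = (sin (?p * z) ^ 2 + cos (?p * z) ^ 2) / (sin (?p * z) * cos (?p * z))"
    unfolding cw using nz by (simp add: cot_def field_simps power2_eq_square)
  also have "\<dots> = 2 / of_real (cosh t)"
    using nz by (simp flip: c)
  finally have "cnj (Digamma w - Digamma z) + (Digamma w - Digamma z) = of_real (2 * pi / cosh t)"
    using * by (simp add: algebra_simps)
  then show ?thesis
    by (simp add: complex_eq_iff z_def[symmetric] w_def[symmetric])
qed

subsection \<open>Polylogarithms of nonpositive order\<close>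

text \<open>Differentiating a power series and multiplying by \<open>z\<close> raises the power of
  \<open>k\<close> by one and preserves convergence in the unit disc.\<close>

lemma summable_of_nat_power_mult_power:
  fixes z :: complex
  assumes "norm z < 1"
  shows "summable (\<lambda>k. of_nat k ^ j * z ^ k)"
  using assms
proof (induction j arbitrary: z)
  case 0
  then show ?case
    by simp
next
  case (Suc j)
  then have "summable (\<lambda>k. z * (diffs (\<lambda>k. of_nat k ^ j) k * z ^ k))"
    by (intro summable_mult termdiff_converges[where K = 1]) auto
  then have "summable (\<lambda>k. of_nat (Suc k) ^ Suc j * z ^ Suc k)"
    by (simp add: diffs_def mult_ac)
  then show ?case
    by (subst (asm) summable_Suc_iff)
qed

lemma polylog_of_nonpos:
  assumes "norm z < 1"
  shows "polylog (- int j) z = z * (\<Sum>k. of_nat (Suc k) ^ j * z ^ k)"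
proof -
  have "summable (\<lambda>k. of_nat (Suc k) ^ j * z ^ k)"
  \<comment> \<open>A factor \<open>z\<close> has to be cancelled from the shifted series; at z = 0
    only the constant term remains.\<close>
  proof (cases "z = 0")
    case False
    have "summable (\<lambda>k. of_nat (Suc k) ^ j * z ^ Suc k)"
      using summable_of_nat_power_mult_power[OF assms, of j] by (subst summable_Suc_iff)
    then have "summable (\<lambda>k. z * (of_nat (Suc k) ^ j * z ^ k))"
      by (simp add: mult_ac)
    then show ?thesis
      using False by (simp only: summable_cmult_iff) simp
  qed (simp add: powser_zero)
  then show ?thesis
    by (simp add: polylog_def power_int_minus divide_inverse mult_ac flip: suminf_mult del: of_nat_Suc)
qed

text \<open>Termwise differentiation: applying z d/dz multiplies the coefficient of z^k by
  \<open>k\<close>, which lowers the order by one.\<close>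

lemma has_field_derivative_polylog:
  assumes "norm z < 1" "z \<noteq> 0"
  shows "(polylog (- int j) has_field_derivative polylog (- int (Suc j)) z / z) (at z)"
proof -
  \<comment> \<open>The coefficient at 0 is set separately: for j = 0, \<open>0 ^ 0\<close> would be
    1, whereas the polylogarithm has no constant term.\<close>
  define c :: "nat \<Rightarrow> complex" where "c = (\<lambda>k. if k = 0 then 0 else of_nat k ^ j)"
  have summable: "summable (\<lambda>k. c k * w ^ k)" if "norm w < 1" for w
  proof -
    have "summable (\<lambda>k. c (Suc k) * w ^ Suc k)"
      using summable_of_nat_power_mult_power[OF that, of j]
      by (subst (asm) summable_Suc_iff[symmetric]) (simp add: c_def del: of_nat_Suc)
    then show ?thesis
      by (subst (asm) summable_Suc_iff)
  qed
  have polylog: "polylog (- int j) w = (\<Sum>k. c k * w ^ k)" if "norm w < 1" for w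
    using suminf_split_head[OF summable[OF that]]
    by (simp add: polylog_def c_def power_int_minus divide_inverse mult_ac del: of_nat_Suc)
  have "((\<lambda>w. \<Sum>k. c k * w ^ k) has_field_derivative (\<Sum>k. diffs c k * z ^ k)) (at z)"
    using summable assms(1) by (rule termdiffs_strong')
  moreover have "(\<Sum>k. diffs c k * z ^ k) = polylog (- int (Suc j)) z / z"
    using assms by (simp add: polylog_of_nonpos diffs_def c_def mult_ac del: of_nat_Suc int_Suc)
  moreover have "eventually (\<lambda>w. w \<in> ball 0 1) (nhds z)"
    using assms by (intro eventually_nhds_in_open) auto
  then have "eventually (\<lambda>w. polylog (- int j) w = (\<Sum>k. c k * w ^ k)) (nhds z)"
    by eventually_elim (simp add: polylog)
  ultimately show ?thesis
    by (subst DERIV_cong_ev[OF refl _ refl]) auto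
qed

text \<open>For j = 0 a geometric series gives 1 / (2 cosh t), which is the digamma difference. Each
  differentiation in \<open>t\<close> then raises \<open>j\<close> on both sides and produces a
  minus sign on both, which cancels.\<close>

lemma Im_polylog_eq_Polygamma:
  fixes t :: real
  assumes "t > 0"
  shows "Im (polylog (- int j) (\<i> * of_real (exp (- t)))) =
    Re ((- \<i> / of_real (2 * pi)) ^ j *
      (Polygamma j (Complex (3/4) (t / (2 * pi))) - Polygamma j (Complex (1/4) (t / (2 * pi))))) / (2 * pi)"
  using assms
proof (induction j arbitrary: t)
  case 0
  define x where "x = exp (- t)"
  have x: "0 < x" "x < 1"
    using 0 by (auto simp: x_def)
  then have "(\<Sum>k. (\<i> * complex_of_real x) ^ k) = 1 / (1 - \<i> * of_real x)"
    by (intro suminf_geometric) (simp add: norm_mult)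
  then have "polylog (- int 0) (\<i> * of_real x) = \<i> * of_real x / (1 - \<i> * of_real x)"
    using x by (subst polylog_of_nonpos) (simp_all add: norm_mult)
  then have "Im (polylog (- int 0) (\<i> * of_real x)) = x / (1 + x\<^sup>2)"
    by (simp add: Im_divide)
  also have "2 * cosh t = (1 + x\<^sup>2) / x"
    using x(1) by (simp add: cosh_field_def x_def exp_minus field_simps power2_eq_square)
  then have "x / (1 + x\<^sup>2) = 1 / (2 * cosh t)"
    by simp
  finally show ?case
    using Re_Digamma_quarters[of t] by (simp add: x_def)
next
  case (Suc j)
  \<comment> \<open>The argument \<open>s\<close> is complex, so that holomorphic derivatives apply
    before restricting to the real line.\<close>
  let ?l = "\<lambda>j s. polylog (- int j) (\<i> * exp (- s))"
  let ?p = "\<lambda>j s. Polygamma j (3/4 + \<i> * s / of_real (2 * pi)) - Polygamma j (1/4 + \<i> * s / of_real (2 * pi))"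
  let ?q = "\<lambda>j s. (- \<i> / of_real (2 * pi)) ^ j * ?p j s"
  have IH: "Im (?l j (of_real u)) = Re (?q j (of_real u)) / (2 * pi)" if "u > 0" for u
    using Suc.IH[OF that] by (simp add: Complex_eq exp_minus exp_of_real)
  have "((\<lambda>s. \<i> * exp (- s)) has_field_derivative - (\<i> * exp (- of_real t))) (at (of_real t))"
    by (auto intro!: derivative_eq_intros)
  moreover have "norm (\<i> * exp (- complex_of_real t)) < 1"
    using Suc.prems by (simp add: norm_mult)
  ultimately have "(?l j has_field_derivative
      ?l (Suc j) (of_real t) / (\<i> * exp (- of_real t)) * - (\<i> * exp (- of_real t))) (at (of_real t))"
    by (intro DERIV_chain2[OF has_field_derivative_polylog]) auto
  then have "(?l j has_field_derivative - ?l (Suc j) (of_real t)) (at (of_real t))"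
    by (rule DERIV_cong) simp
  from bounded_linear.has_vector_derivative[OF bounded_linear_Im has_vector_derivative_real_field[OF this]]
  have 1: "((\<lambda>u. Im (?l j (of_real u))) has_real_derivative - Im (?l (Suc j) (of_real t))) (at t)"
    by (simp add: has_real_derivative_iff_has_vector_derivative)
  have nonpos: "3/4 + \<i> * of_real t / of_real (2 * pi) \<notin> \<int>\<^sub>\<le>\<^sub>0" "1/4 + \<i> * of_real t / of_real (2 * pi) \<notin> \<int>\<^sub>\<le>\<^sub>0"
    by (auto simp: complex_eq_iff elim!: nonpos_Ints_cases)
  have "(?q j has_field_derivative - ?q (Suc j) (of_real t)) (at (of_real t))"
    using nonpos by (auto intro!: derivative_eq_intros simp: algebra_simps)
  from bounded_linear.has_vector_derivative[OF bounded_linear_Re has_vector_derivative_real_field[OF this]]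
  have "((\<lambda>u. Re (?q j (of_real u))) has_real_derivative - Re (?q (Suc j) (of_real t))) (at t)"
    by (simp add: has_real_derivative_iff_has_vector_derivative)
  then have 2: "((\<lambda>u. Re (?q j (of_real u)) / (2 * pi)) has_real_derivative
      - Re (?q (Suc j) (of_real t)) / (2 * pi)) (at t)"
    by (rule DERIV_cdivide)
  \<comment> \<open>The induction hypothesis holds on the open half-line around \<open>t\<close>, so
    the two sides have the same derivative at \<open>t\<close>.\<close>
  have "eventually (\<lambda>u. Im (?l j (of_real u)) = Re (?q j (of_real u)) / (2 * pi)) (nhds t)"
    using eventually_nhds_in_open[of "{0<..}" t] Suc.prems IH by (auto elim!: eventually_mono)
  with 1 have "((\<lambda>u. Re (?q j (of_real u)) / (2 * pi)) has_real_derivative - Im (?l (Suc j) (of_real t))) (at t)"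
    by (subst (asm) DERIV_cong_ev[OF refl _ refl]) auto
  from DERIV_unique[OF this 2] have "Im (?l (Suc j) (of_real t)) = Re (?q (Suc j) (of_real t)) / (2 * pi)"
    by (simp only: minus_divide_left[symmetric] neg_equal_iff_equal)
  then show ?case
    by (simp add: Complex_eq exp_minus exp_of_real)
qed

section \<open>The substitution x = exp (-t)\<close>

text \<open>The change of variables is made for absolutely integrable functions with respect to the
  completed measure. Continuity of \<open>h\<close> supplies the Borel measurability needed to
  return to \<open>lborel\<close>.\<close>

lemma
  fixes h :: "real \<Rightarrow> real"
  assumes cont: "continuous_on {0<..<1} h"
    and int: "set_integrable lborel {0<..} (\<lambda>t. exp (- t) * h (exp (- t)))"
  shows set_integrable_exp_substitution: "set_integrable lborel {0<..<1} h"
    and set_integral_exp_substitution: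
      "(LBINT x:{0<..<1}. h x) = (LBINT t:{0<..}. exp (- t) * h (exp (- t)))"
proof -
  let ?g = "\<lambda>t. exp (- t) * h (exp (- t))"
  have image: "(\<lambda>t::real. exp (- t)) ` {0<..} = {0<..<1}"
  proof (intro equalityI subsetI)
    fix x :: real assume "x \<in> {0<..<1}"
    then show "x \<in> (\<lambda>t. exp (- t)) ` {0<..}"
      by (intro image_eqI[of _ _ "- ln x"]) auto
  qed auto
  have "?g absolutely_integrable_on {0<..}"
    using int integrable_completion[of "\<lambda>t. indicator {0<..} t *\<^sub>R ?g t" lborel]
    by (auto simp: set_integrable_def dest: borel_measurable_integrable)
  moreover have "((\<lambda>t. \<bar>- exp (- t)\<bar> *\<^sub>R h (exp (- t))) absolutely_integrable_on {0<..} \<and>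
        integral {0<..} (\<lambda>t. \<bar>- exp (- t)\<bar> *\<^sub>R h (exp (- t))) = integral {0<..} ?g) \<longleftrightarrow>
      h absolutely_integrable_on (\<lambda>t. exp (- t)) ` {0<..} \<and>
        integral ((\<lambda>t. exp (- t)) ` {0<..}) h = integral {0<..} ?g"
    by (intro has_absolute_integral_change_of_variables_real)
      (auto simp: inj_on_def intro!: derivative_eq_intros)
  ultimately have h: "h absolutely_integrable_on {0<..<1}" "integral {0<..<1} h = integral {0<..} ?g"
    by (simp_all add: image)
  have "(\<lambda>x. indicator {0<..<1} x *\<^sub>R h x) \<in> borel_measurable borel"
    using cont by (intro borel_measurable_continuous_on_indicator) auto
  then show *: "set_integrable lborel {0<..<1} h"
    using h(1) integrable_completion[of "\<lambda>x. indicator {0<..<1} x *\<^sub>R h x" lborel]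
    by (simp add: set_integrable_def)
  show "(LBINT x:{0<..<1}. h x) = (LBINT t:{0<..}. ?g t)"
    using h(2) set_borel_integral_eq_integral(2)[OF *] set_borel_integral_eq_integral(2)[OF int] by simp
qed

section \<open>Beta at integers as a difference of two shifted power sums\<close>

text \<open>Consecutive terms of the alternating series are paired: 4k + 1 and 4k + 3 are 4 (1/4 +
  k) and 4 (3/4 + k), which match the two polygamma arguments.\<close>

lemma dirichlet_beta_of_nat_sums:
  assumes "m \<ge> 2"
  obtains b where "dirichlet_beta (of_nat m) = complex_of_real b"
    "(\<lambda>k. inverse (4 ^ m) * (inverse ((1/4 + real k) ^ m) - inverse ((3/4 + real k) ^ m))) sums b"
proof -
  define f :: "nat \<Rightarrow> real" where "f = (\<lambda>k. (-1) ^ k / real (2 * k + 1) ^ m)"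
  have "summable f"
  proof (rule summable_comparison_test)
    show "summable (\<lambda>k. 1 / real k ^ m)"
      using inverse_power_summable[of m, where 'a = real] assms by (simp add: divide_inverse)
    show "\<exists>N. \<forall>k\<ge>N. norm (f k) \<le> 1 / real k ^ m"
      \<comment> \<open>The index 0 is skipped because \<open>1 / real 0 ^ m\<close> is 0.\<close>
      by (intro exI[of _ 1]) (auto simp: f_def power_abs intro!: divide_left_mono power_mono)
  qed
  then have sums: "f sums suminf f"
    by (rule summable_sums)
  have "(\<lambda>k. complex_of_real (f k)) sums of_real (suminf f)"
    using sums by (rule sums_of_real)
  moreover have "complex_of_real (f k) = (-1) ^ k / of_nat (2 * k + 1) powr of_nat m" for k
    using assms by (subst powr_nat') (simp_all add: f_def)
  ultimately have "dirichlet_beta (of_nat m) = complex_of_real (suminf f)"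
    by (simp add: dirichlet_beta_def sums_iff)
  moreover have "(\<lambda>k. sum f {k * 2..<k * 2 + 2}) sums suminf f"
    using sums by (rule sums_group) simp
  moreover have "sum f {k * 2..<k * 2 + 2} =
      inverse (4 ^ m) * (inverse ((1/4 + real k) ^ m) - inverse ((3/4 + real k) ^ m))" for k
  proof -
    have "{k * 2..<k * 2 + 2} = {2 * k, 2 * k + 1}"
      by auto
    then have "sum f {k * 2..<k * 2 + 2} = f (2 * k) + f (2 * k + 1)"
      by simp
    moreover have 1: "real (2 * (2 * k) + 1) = 4 * (1/4 + real k)"
      and 3: "real (2 * (2 * k + 1) + 1) = 4 * (3/4 + real k)"
      by simp_all
    have "f (2 * k) = 1 / (4 ^ m * (1/4 + real k) ^ m)"
      by (simp only: f_def 1 power_mult_distrib) simp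
    moreover have "f (2 * k + 1) = - (1 / (4 ^ m * (3/4 + real k) ^ m))"
      by (simp only: f_def 3 power_mult_distrib) simp
    ultimately show ?thesis
      by (simp only: inverse_eq_divide right_diff_distrib times_divide_times_eq mult_1 add_uminus_conv_diff)
  qed
  ultimately show ?thesis
    using that by simp
qed

section \<open>Evaluation of the integral by comparing the two series\<close>

theorem proposition2p2:
  fixes n :: nat
  assumes "n \<ge> 1"
  shows "set_integrable lborel {0<..<1}
           (\<lambda>x::real. Im (polylog (- 2 * int n) (\<i> * complex_of_real x)) / x * ln (ln (1 / x))) \<and>
         complex_of_real
           (LBINT x:{0<..<1}. Im (polylog (- 2 * int n) (\<i> * complex_of_real x)) / x * ln (ln (1 / x))) =
           (-1) ^ (n + 1) * (2 ^ (2 * n - 1) * fact (2 * n - 1) / complex_of_real pi ^ (2 * n - 1))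
             * dirichlet_beta (of_nat (2 * n))"
proof -
  define m where "m = 2 * n"
  have m: "m \<ge> 2"
    using assms by (simp add: m_def)
  let ?h = "\<lambda>x. Im (polylog (- int m) (\<i> * complex_of_real x)) / x * ln (ln (1 / x))"
  let ?p = "\<lambda>c t. Re (Polygamma m (Complex c (t / (2 * pi)))) * ln t"
  \<comment> \<open>The power (-\<i>/(2 pi))^(2n) is real and equals (-1)^n / (2 pi)^m; the
    remaining 1/(2 pi) is the prefactor in \<open>Im_polylog_eq_Polygamma\<close>.\<close>
  define C where "C = (-1) ^ n / (2 * pi) ^ Suc m"
  have quarters: "2 * pi * (1/4) \<ge> 1" "2 * pi * (3/4) \<ge> 1"
    using pi_ge_two by auto
  note int = set_integrable_Polygamma_log[OF quarters(1) m] set_integrable_Polygamma_log[OF quarters(2) m]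
  note sums = sums_integral_Polygamma_log[OF quarters(1) m] sums_integral_Polygamma_log[OF quarters(2) m]
  \<comment> \<open>The Jacobian exp (-t) cancels the division by x, and ln (1/x) becomes
    \<open>t\<close>.\<close>
  have eq: "exp (- t) * ?h (exp (- t)) = C * (?p (3/4) t - ?p (1/4) t)" if "t > 0" for t
  proof -
    have "(- \<i> / of_real (2 * pi)) ^ m = of_real ((-1) ^ n / (2 * pi) ^ m)"
    proof -
      have "(- \<i> / of_real (2 * pi)) ^ 2 = complex_of_real (- 1 / (2 * pi) ^ 2)"
        by (simp add: power2_eq_square)
      then show ?thesis
        by (simp only: m_def power_mult power_divide flip: of_real_power)
    qed
    then have "Im (polylog (- int m) (\<i> * of_real (exp (- t)))) =
        C * Re (Polygamma m (Complex (3/4) (t / (2 * pi))) - Polygamma m (Complex (1/4) (t / (2 * pi))))"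
      using Im_polylog_eq_Polygamma[OF that, of m] by (simp add: C_def)
    moreover have "e * (y / e * l) = y * l" if "e \<noteq> 0" for e y l :: real
      using that by simp
    moreover have "ln (ln (1 / exp (- t))) = ln t"
      by (simp add: ln_div)
    ultimately show ?thesis
      by (simp only: exp_not_eq_zero not_False_eq_True minus_complex.sel mult.assoc left_diff_distrib)
  qed
  have int_g: "set_integrable lborel {0<..} (\<lambda>t. exp (- t) * ?h (exp (- t)))"
  proof (rule set_integrable_cong[THEN iffD2])
    show "set_integrable lborel {0<..} (\<lambda>t. C * (?p (3/4) t - ?p (1/4) t))"
      using int by (intro set_integrable_mult_right set_integral_diff)
  qed (use eq in auto)
  have cont: "continuous_on {0<..<1} ?h"
  proof -
    have "isCont (\<lambda>x. polylog (- int m) (\<i> * complex_of_real x)) x" if "x \<in> {0<..<1}" for x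
      using that by (intro isCont_o2[OF _ DERIV_isCont[OF has_field_derivative_polylog]])
        (auto simp: norm_mult)
    then have "continuous_on {0<..<1} (\<lambda>x. polylog (- int m) (\<i> * complex_of_real x))"
      by (simp add: continuous_at_imp_continuous_on)
    then show ?thesis
      by (intro continuous_intros) auto
  qed
  have "(LBINT x:{0<..<1}. ?h x) = (LBINT t:{0<..}. exp (- t) * ?h (exp (- t)))"
    by (rule set_integral_exp_substitution[OF cont int_g])
  also have "\<dots> = (LBINT t:{0<..}. C * (?p (3/4) t - ?p (1/4) t))"
    using eq by (intro set_lebesgue_integral_cong) auto
  also have "\<dots> = C * ((LBINT t:{0<..}. ?p (3/4) t) - (LBINT t:{0<..}. ?p (1/4) t))"
    using int by (simp only: set_integral_mult_right set_integral_diff)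
  finally have integral: "(LBINT x:{0<..<1}. ?h x) = \<dots>" .
  obtain b where b: "dirichlet_beta (of_nat m) = complex_of_real b"
    "(\<lambda>k. inverse (4 ^ m) * (inverse ((1/4 + real k) ^ m) - inverse ((3/4 + real k) ^ m))) sums b"
    using dirichlet_beta_of_nat_sums[OF m] by blast
  \<comment> \<open>The minus sign reflects the order 3/4 minus 1/4, opposite to that in the beta
    series; 4^m undoes the scaling there. As \<open>m\<close> is even, the signs (-1)^m of the
    polygamma sums disappear.\<close>
  let ?D = "- (fact (m - 1) * pi\<^sup>2 * 4 ^ m)"
  have "(\<lambda>k. ?D * (inverse (4 ^ m) * (inverse ((1/4 + real k) ^ m) - inverse ((3/4 + real k) ^ m)))) sums (?D * b)"
    using b(2) by (rule sums_mult)
  moreover have "(\<lambda>k. ?D * (inverse (4 ^ m) * (inverse ((1/4 + real k) ^ m) - inverse ((3/4 + real k) ^ m)))) sums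
      ((LBINT t:{0<..}. ?p (3/4) t) - (LBINT t:{0<..}. ?p (1/4) t))"
  proof -
    have "- (f * p * z) * (inverse z * (u - v)) = (-1) ^ m * f * p * v - (-1) ^ m * f * p * u"
      if "z = 4 ^ m" for f p z u v :: real
      using that by (simp add: m_def field_simps)
    note this[OF refl]
    then show ?thesis
      using sums_diff[OF sums(2,1)] by (simp only:)
  qed
  ultimately have "(LBINT t:{0<..}. ?p (3/4) t) - (LBINT t:{0<..}. ?p (1/4) t) = ?D * b"
    by (rule sums_unique2[symmetric])
  \<comment> \<open>Here 4^m pi^2 / (2 pi)^(m+1) equals 2^(m-1) / pi^(m-1), and the sign of
    \<open>?D\<close> turns (-1)^n into (-1)^(n+1).\<close>
  moreover have "C * ?D = (-1) ^ (n + 1) * (2 ^ (m - 1) * fact (m - 1) / pi ^ (m - 1))"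
  proof -
    obtain k where k: "m = Suc k"
      using m by (cases m) auto
    have "(4::real) ^ m = 2 ^ m * 2 ^ m"
      by (simp flip: power_mult_distrib)
    then show ?thesis
      by (simp add: C_def k power_mult_distrib field_simps power2_eq_square)
  qed
  ultimately have "(LBINT x:{0<..<1}. ?h x) =
      (-1) ^ (n + 1) * (2 ^ (m - 1) * fact (m - 1) / pi ^ (m - 1)) * b"
    using integral by (simp only: mult.assoc[symmetric])
  then have "complex_of_real (LBINT x:{0<..<1}. ?h x) =
      (-1) ^ (n + 1) * (2 ^ (m - 1) * fact (m - 1) / of_real pi ^ (m - 1)) * dirichlet_beta (of_nat m)"
    by (simp only: b) simp
  with set_integrable_exp_substitution[OF cont int_g] show ?thesis
    by (simp add: m_def)
qed

end
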